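(* Dominating sets can be learned by extended equivalence queries and membership queries in $O(n^2)$ rounds: there is a learning algorithm using extended equivalence queries and membership queries that, for every graph $G$ on $\{1,\dots,n\}$ and every competent Teacher, produces a hypothesis equivalent to $G$ with respect to the dominating set concept after $O(n^2)$ queries in total.
   Context: A vertex set concept is a predicate $\Phi(G,V')$ on finite graphs $G$ and sets $V'\subseteq V(G)$; its solution set is $S(G)=\{V'\subseteq V(G):\Phi(G,V')\}$. Here $\Phi(G,V')$ means "$V'$ is a dominating set of $G$", i.e. every vertex of $G$ either lies in $V'$ or is adjacent to a vertex of $V'$. Learning model (exact learning by extended equivalence and membership queries): a Teacher privately holds a graph $G$ with vertex set $V=\{1,\dots,n\}$, and the Learner initially knows only $n$. - In a membership query the Learner presents a set $V'\subseteq\{1,\dots,n\}$, and the Teacher answers whether $\Phi(G,V')$ holds. - In an extended equivalence query the Learner presents a Boolean circuit $C$ with $n$ inputs and one output. A set $U\subseteq\{1,\dots,n\}$ is identified with its characteristic $0$-$1$ vector. The circuit $C$ is equivalent to $G$ if $C$ outputs $1$ exactly on the characteristic vectors of the sets in $S(G)$. If $C$ is equivalent, the Teacher answers "finished". Otherwise the Teacher returns a counterexample: either a positive counterexample, i.e. a set in $S(G)$ rejected by $C$, or a negative counterexample, i.e. a set accepted by $C$ but not in $S(G)$. A Teacher is competent if it always answers correctly; it may choose any valid counterexample. A learning algorithm is a Learner strategy that, against every competent Teacher and every $G$, eventually obtains "finished". It runs in $f(n)$ rounds if, for every graph of order $n$ and every competent Teacher, it finishes after at most $f(n)$ queries. 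*)

theory Defs
  imports "Graph_Theory.Pair_Digraph" "HOL-Library.Landau_Symbols"
begin

text \<open>The locale \<^locale>\<open>pair_graph\<close> describes finite undirected simple graphs: an edge is
  represented by its two opposite arcs, and there are no loops.\<close>

type_synonym vgraph = "nat pair_pre_digraph"

definition graph_on :: "nat \<Rightarrow> vgraph \<Rightarrow> bool" where
  "graph_on n G \<longleftrightarrow> pair_graph G \<and> pverts G = {1..n}"

type_synonym vertex_set_concept = "vgraph \<Rightarrow> nat set \<Rightarrow> bool"

definition solutions :: "vertex_set_concept \<Rightarrow> vgraph \<Rightarrow> nat set set" where
  "solutions \<Phi> G = {V'. V' \<subseteq> pverts G \<and> \<Phi> G V'}"

definition dominating_set :: vertex_set_concept where
  "dominating_set G V' \<longleftrightarrow>
     V' \<subseteq> pverts G \<and> (\<forall>v\<in>pverts G. v \<in> V' \<or> (\<exists>u\<in>V'. (v, u) \<in> parcs G))"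

text \<open>A circuit is a topologically ordered, 0-indexed list of gates. The number arguments of
  negation, conjunction and disjunction gates are positions of earlier gates (fan-out is
  unrestricted), whereas the argument of \<open>InputG\<close> is the index of one of the inputs
  \<open>1, \<dots>, n\<close>. The last gate is the output.\<close>

datatype gate = InputG nat | ConstG bool | NotG nat | AndG nat nat | OrG nat nat

type_synonym circuit = "gate list"

fun wf_gate :: "nat \<Rightarrow> nat \<Rightarrow> gate \<Rightarrow> bool" where
  "wf_gate n k (InputG i) \<longleftrightarrow> i \<in> {1..n}"
| "wf_gate n k (ConstG b) \<longleftrightarrow> True"
| "wf_gate n k (NotG i) \<longleftrightarrow> i < k"
| "wf_gate n k (AndG i j) \<longleftrightarrow> i < k \<and> j < k"
| "wf_gate n k (OrG i j) \<longleftrightarrow> i < k \<and> j < k"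

definition wf_circuit :: "nat \<Rightarrow> circuit \<Rightarrow> bool" where
  "wf_circuit n C \<longleftrightarrow> C \<noteq> [] \<and> (\<forall>k<length C. wf_gate n k (C ! k))"

text \<open>In the following, \<open>x\<close> is the input vector and \<open>vs\<close> the list of values of the
  gates that have already been evaluated.\<close>

fun gate_value :: "(nat \<Rightarrow> bool) \<Rightarrow> bool list \<Rightarrow> gate \<Rightarrow> bool" where
  "gate_value x vs (InputG i) = x i"
| "gate_value x vs (ConstG b) = b"
| "gate_value x vs (NotG i) = (\<not> vs ! i)"
| "gate_value x vs (AndG i j) = (vs ! i \<and> vs ! j)"
| "gate_value x vs (OrG i j) = (vs ! i \<or> vs ! j)"

definition circuit_output :: "circuit \<Rightarrow> (nat \<Rightarrow> bool) \<Rightarrow> bool" where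
  "circuit_output C x = last (foldl (\<lambda>vs g. vs @ [gate_value x vs g]) [] C)"

definition accepts :: "circuit \<Rightarrow> nat set \<Rightarrow> bool" where
  "accepts C U \<longleftrightarrow> circuit_output C (\<lambda>i. i \<in> U)"

definition equivalent :: "vertex_set_concept \<Rightarrow> vgraph \<Rightarrow> circuit \<Rightarrow> bool" where
  "equivalent \<Phi> G C \<longleftrightarrow> (\<forall>U\<subseteq>pverts G. accepts C U \<longleftrightarrow> U \<in> solutions \<Phi> G)"

datatype query = MembershipQuery "nat set" | EquivalenceQuery circuit

datatype answer =
    MembershipAnswer bool
  | Finished
  | PositiveCounterexample "nat set"
  | NegativeCounterexample "nat set"

fun legal_query :: "nat \<Rightarrow> query \<Rightarrow> bool" where
  "legal_query n (MembershipQuery V') \<longleftrightarrow> V' \<subseteq> {1..n}"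
| "legal_query n (EquivalenceQuery C) \<longleftrightarrow> wf_circuit n C"

fun correct_answer :: "vertex_set_concept \<Rightarrow> vgraph \<Rightarrow> query \<Rightarrow> answer \<Rightarrow> bool" where
  "correct_answer \<Phi> G (MembershipQuery V') (MembershipAnswer b) \<longleftrightarrow> b = \<Phi> G V'"
| "correct_answer \<Phi> G (EquivalenceQuery C) Finished \<longleftrightarrow> equivalent \<Phi> G C"
| "correct_answer \<Phi> G (EquivalenceQuery C) (PositiveCounterexample U) \<longleftrightarrow>
     U \<in> solutions \<Phi> G \<and> \<not> accepts C U"
| "correct_answer \<Phi> G (EquivalenceQuery C) (NegativeCounterexample U) \<longleftrightarrow>
     U \<subseteq> pverts G \<and> accepts C U \<and> U \<notin> solutions \<Phi> G"
| "correct_answer \<Phi> G _ _ \<longleftrightarrow> False"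

text \<open>A history lists the queries asked so far together with their answers, oldest first.
  A Learner knows only the order \<open>n\<close> and the history; a Teacher may choose its answers
  adaptively, depending on the history and the current query.\<close>

type_synonym history = "(query \<times> answer) list"
type_synonym learner = "nat \<Rightarrow> history \<Rightarrow> query"
type_synonym teacher = "history \<Rightarrow> query \<Rightarrow> answer"

definition learner_strategy :: "learner \<Rightarrow> bool" where
  "learner_strategy L \<longleftrightarrow> (\<forall>n h. legal_query n (L n h))"

definition competent :: "vertex_set_concept \<Rightarrow> nat \<Rightarrow> vgraph \<Rightarrow> teacher \<Rightarrow> bool" where
  "competent \<Phi> n G T \<longleftrightarrow> (\<forall>h q. legal_query n q \<longrightarrow> correct_answer \<Phi> G q (T h q))"

definition finished :: "history \<Rightarrow> bool" where
  "finished h \<longleftrightarrow> Finished \<in> snd ` set h"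

text \<open>The history after at most \<open>m\<close> queries; the interaction stops once the Teacher has
  answered \<open>Finished\<close>.\<close>

primrec play :: "learner \<Rightarrow> teacher \<Rightarrow> nat \<Rightarrow> nat \<Rightarrow> history" where
  "play L T n 0 = []"
| "play L T n (Suc m) =
     (let h = play L T n m; q = L n h in if finished h then h else h @ [(q, T h q)])"

definition learning_algorithm :: "vertex_set_concept \<Rightarrow> learner \<Rightarrow> bool" where
  "learning_algorithm \<Phi> L \<longleftrightarrow> learner_strategy L \<and>
     (\<forall>n G T. graph_on n G \<longrightarrow> competent \<Phi> n G T \<longrightarrow> (\<exists>m. finished (play L T n m)))"

definition runs_in_rounds :: "vertex_set_concept \<Rightarrow> learner \<Rightarrow> (nat \<Rightarrow> nat) \<Rightarrow> bool" where
  "runs_in_rounds \<Phi> L f \<longleftrightarrow>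
     (\<forall>n G T. graph_on n G \<longrightarrow> competent \<Phi> n G T \<longrightarrow> finished (play L T n (f n)))"

end

theory Submission
  imports Defs
begin

text \<open>A set dominates iff it meets every closed neighbourhood, so the concept is a monotone CNF with
  at most \<open>n\<close> clauses and Angluin's algorithm applies. The hypothesis is always a conjunction of
  closed neighbourhoods, hence every counterexample is negative: a non-dominating set meeting all
  clauses found so far. With \<open>n\<close> membership queries it is enlarged greedily to a maximal
  non-dominating set, whose complement is a new closed neighbourhood. After at most \<open>n\<close> rounds of
  \<open>n + 1\<close> queries all relevant clauses are known.\<close>

section \<open>Compiling monotone formulas to circuits\<close>

datatype formula = Var nat | Const bool | And formula formula | Or formula formula

primrec holds :: "(nat \<Rightarrow> bool) \<Rightarrow> formula \<Rightarrow> bool" where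
  "holds x (Var i) \<longleftrightarrow> x i"
| "holds x (Const b) \<longleftrightarrow> b"
| "holds x (And f g) \<longleftrightarrow> holds x f \<and> holds x g"
| "holds x (Or f g) \<longleftrightarrow> holds x f \<or> holds x g"

primrec vars :: "formula \<Rightarrow> nat set" where
  "vars (Var i) = {i}"
| "vars (Const b) = {}"
| "vars (And f g) = vars f \<union> vars g"
| "vars (Or f g) = vars f \<union> vars g"

text \<open>The number \<open>k\<close> is the position at which the compiled gates will be placed.\<close>

primrec compile :: "formula \<Rightarrow> nat \<Rightarrow> circuit" where
  "compile (Var i) k = [InputG i]"
| "compile (Const b) k = [ConstG b]"
| "compile (And f g) k =
     (let C = compile f k; l = k + length C; D = compile g l
      in C @ D @ [AndG (l - 1) (l + length D - 1)])"
| "compile (Or f g) k =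
     (let C = compile f k; l = k + length C; D = compile g l
      in C @ D @ [OrG (l - 1) (l + length D - 1)])"

text \<open>Names the fold inside \<open>circuit_output\<close>, so that the values of inner gates
  can be tracked as well as the output.\<close>

definition gate_values :: "(nat \<Rightarrow> bool) \<Rightarrow> circuit \<Rightarrow> bool list" where
  "gate_values x C = foldl (\<lambda>vs g. vs @ [gate_value x vs g]) [] C"

lemma gate_values_Nil [simp]: "gate_values x [] = []"
  by (simp add: gate_values_def)

lemma gate_values_snoc [simp]:
  "gate_values x (C @ [g]) = gate_values x C @ [gate_value x (gate_values x C) g]"
  by (simp add: gate_values_def)

lemma length_gate_values [simp]: "length (gate_values x C) = length C"
  by (induction C rule: rev_induct) simp_all

lemma nth_gate_values_append:
  "i < length C \<Longrightarrow> gate_values x (C @ D) ! i = gate_values x C ! i"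
proof (induction D rule: rev_induct)
  case (snoc g D)
  then show ?case
    using gate_values_snoc[of x "C @ D" g] by (simp add: nth_append)
qed simp

lemma compile_not_Nil [simp]: "compile f k \<noteq> []"
  by (cases f) (simp_all add: Let_def)

text \<open>The prefix \<open>C\<close> is arbitrary because the second operand is compiled behind
  the gates of the first. Gates added later leave earlier values unchanged, so both operand values
  are still available to the joining gate.\<close>

lemma gate_values_compile:
  "gate_values x (C @ compile f (length C)) ! (length C + length (compile f (length C)) - 1)
   = holds x f"
proof (induction f arbitrary: C)
  case (Var i)
  show ?case using gate_values_snoc[of x C] by (simp add: nth_append)
next
  case (Const b)
  show ?case using gate_values_snoc[of x C] by (simp add: nth_append)
next
  case (And f g)
  define A where "A = C @ compile f (length C)"
  define B where "B = A @ compile g (length A)"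
  have "length A > 0" "length B > 0"
    by (simp_all add: A_def B_def)
  moreover have "gate_values x A ! (length A - 1) = holds x f"
    using And.IH(1)[of C] by (simp add: A_def)
  moreover have "gate_values x B ! (length A - 1) = gate_values x A ! (length A - 1)"
    unfolding B_def using \<open>length A > 0\<close> by (intro nth_gate_values_append) simp
  moreover have "gate_values x B ! (length B - 1) = holds x g"
    using And.IH(2)[of A] by (simp add: B_def)
  moreover have "C @ compile (And f g) (length C) = B @ [AndG (length A - 1) (length B - 1)]"
    by (simp add: Let_def A_def B_def)
  moreover have "length C + length (compile (And f g) (length C)) - 1 = length B"
    by (simp add: Let_def A_def B_def)
  ultimately show ?case
    by (simp add: nth_append)
next
  case (Or f g)
  define A where "A = C @ compile f (length C)"
  define B where "B = A @ compile g (length A)"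
  have "length A > 0" "length B > 0"
    by (simp_all add: A_def B_def)
  moreover have "gate_values x A ! (length A - 1) = holds x f"
    using Or.IH(1)[of C] by (simp add: A_def)
  moreover have "gate_values x B ! (length A - 1) = gate_values x A ! (length A - 1)"
    unfolding B_def using \<open>length A > 0\<close> by (intro nth_gate_values_append) simp
  moreover have "gate_values x B ! (length B - 1) = holds x g"
    using Or.IH(2)[of A] by (simp add: B_def)
  moreover have "C @ compile (Or f g) (length C) = B @ [OrG (length A - 1) (length B - 1)]"
    by (simp add: Let_def A_def B_def)
  moreover have "length C + length (compile (Or f g) (length C)) - 1 = length B"
    by (simp add: Let_def A_def B_def)
  ultimately show ?case
    by (simp add: nth_append)
qed

lemma accepts_compile: "accepts (compile f 0) U \<longleftrightarrow> holds (\<lambda>i. i \<in> U) f"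
proof -
  have "gate_values x (compile f 0) \<noteq> []" for x
    by (metis compile_not_Nil length_0_conv length_gate_values)
  then show ?thesis
    using gate_values_compile[of _ "[]" f]
    by (simp add: accepts_def circuit_output_def last_conv_nth flip: gate_values_def)
qed

lemma wf_gates_append:
  "(\<forall>k<length (C @ D). wf_gate n (p + k) ((C @ D) ! k)) \<longleftrightarrow>
   (\<forall>k<length C. wf_gate n (p + k) (C ! k)) \<and>
   (\<forall>k<length D. wf_gate n (p + length C + k) (D ! k))"
proof -
  have "(\<forall>k<length C + length D. P k) \<longleftrightarrow> (\<forall>k<length C. P k) \<and> (\<forall>k<length D. P (length C + k))"
    (is "?L \<longleftrightarrow> ?R") for P :: "nat \<Rightarrow> bool"
  proof
    assume R: ?R
    show ?L
    proof (intro allI impI)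
      fix k assume "k < length C + length D"
      then show "P k"
        using R by (cases "k < length C") (auto dest: spec[of _ "k - length C"])
    qed
  qed simp
  then show ?thesis
    by (simp add: nth_append add.assoc)
qed

text \<open>Compiled blocks are nonempty, so their last positions lie strictly below the gate
  joining them. The offset \<open>p\<close> varies in the induction, as the second block starts
  after the first.\<close>

lemma wf_gates_compile:
  assumes "vars f \<subseteq> {1..n}"
  shows "\<forall>k<length (compile f p). wf_gate n (p + k) (compile f p ! k)"
  using assms
proof (induction f arbitrary: p)
  case (And f g)
  then show ?case
    unfolding compile.simps Let_def wf_gates_append
    by (simp add: less_le_trans[OF diff_less])
next
  case (Or f g)
  then show ?case
    unfolding compile.simps Let_def wf_gates_append
    by (simp add: less_le_trans[OF diff_less])
qed simp_all

lemma wf_circuit_compile: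
  assumes "vars f \<subseteq> {1..n}"
  shows "wf_circuit n (compile f 0)"
  using wf_gates_compile[OF assms, of 0] by (simp add: wf_circuit_def)

text \<open>Filtering \<open>[1..<Suc n]\<close> turns the set into a list and keeps the variables
  in range for every \<open>K\<close>, even an infinite one.\<close>

definition clause :: "nat \<Rightarrow> nat set \<Rightarrow> formula" where
  "clause n K = foldr (\<lambda>i. Or (Var i)) (filter (\<lambda>i. i \<in> K) [1..<Suc n]) (Const False)"

definition cnf :: "nat \<Rightarrow> nat set list \<Rightarrow> formula" where
  "cnf n Ks = foldr (\<lambda>K. And (clause n K)) Ks (Const True)"

lemma holds_foldr_Or: "holds x (foldr (\<lambda>i. Or (Var i)) is (Const False)) \<longleftrightarrow> (\<exists>i\<in>set is. x i)"
  by (induction "is") simp_all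

lemma vars_foldr_Or: "vars (foldr (\<lambda>i. Or (Var i)) is (Const False)) = set is"
  by (induction "is") simp_all

lemma holds_cnf: "holds x (cnf n Ks) \<longleftrightarrow> (\<forall>K\<in>set Ks. \<exists>i\<in>K \<inter> {1..n}. x i)"
proof -
  have "holds x (clause n K) \<longleftrightarrow> (\<exists>i\<in>K \<inter> {1..n}. x i)" for K
    by (auto simp: clause_def holds_foldr_Or less_Suc_eq_le simp del: upt_Suc)
  then show ?thesis
    unfolding cnf_def by (induction Ks) auto
qed

lemma vars_cnf: "vars (cnf n Ks) \<subseteq> {1..n}"
proof -
  have "vars (clause n K) \<subseteq> {1..n}" for K
    by (auto simp: clause_def vars_foldr_Or simp del: upt_Suc)
  then show ?thesis
    unfolding cnf_def by (induction Ks) auto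
qed

section \<open>The learner\<close>

text \<open>\<open>Hypothesis Ks\<close>: about to ask whether the clauses \<open>Ks\<close> suffice. \<open>Extending Ks U i\<close>: growing
  the non-dominating set \<open>U\<close>; the vertices below \<open>i\<close> have been tried.\<close>

datatype state = Hypothesis "nat set list" | Extending "nat set list" "nat set" nat

fun next_state :: "nat \<Rightarrow> state \<Rightarrow> answer \<Rightarrow> state" where
  "next_state n (Hypothesis Ks) (NegativeCounterexample U) = Extending Ks U 1"
| "next_state n (Extending Ks U i) (MembershipAnswer b) =
     (let U' = (if b then U else insert i U)
      in if i = n then Hypothesis (({1..n} - U') # Ks) else Extending Ks U' (Suc i))"
| "next_state n s _ = s"

text \<open>The intersection with \<open>{1..n}\<close> only serves to make the query legal on unreachable states.\<close>

fun query_of :: "nat \<Rightarrow> state \<Rightarrow> query" where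
  "query_of n (Hypothesis Ks) = EquivalenceQuery (compile (cnf n Ks) 0)"
| "query_of n (Extending Ks U i) = MembershipQuery (insert i U \<inter> {1..n})"

text \<open>A learner has no memory besides the history, so its state is replayed from the answers.
  These suffice, since each query is a function of the state.\<close>

definition state_of :: "nat \<Rightarrow> history \<Rightarrow> state" where
  "state_of n h = foldl (next_state n) (Hypothesis []) (map snd h)"

definition cnf_learner :: learner where
  "cnf_learner n h = query_of n (state_of n h)"

lemma state_of_snoc: "state_of n (h @ [(q, a)]) = next_state n (state_of n h) a"
  by (simp add: state_of_def)

lemma legal_query_of: "legal_query n (query_of n s)"
  by (cases s) (simp_all add: wf_circuit_compile[OF vars_cnf])

lemma learner_strategy_cnf_learner: "learner_strategy cnf_learner"
  by (simp add: learner_strategy_def cnf_learner_def legal_query_of)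

section \<open>Closed neighbourhoods as clauses\<close>

definition closed_nbh :: "vgraph \<Rightarrow> nat \<Rightarrow> nat set" where
  "closed_nbh G v = insert v {u. (v, u) \<in> parcs G}"

definition closed_nbhs :: "vgraph \<Rightarrow> nat set set" where
  "closed_nbhs G = closed_nbh G ` pverts G"

lemma dominating_set_iff:
  "dominating_set G U \<longleftrightarrow> U \<subseteq> pverts G \<and> (\<forall>N\<in>closed_nbhs G. N \<inter> U \<noteq> {})"
  by (fastforce simp: dominating_set_def closed_nbhs_def closed_nbh_def)

lemma closed_nbhs_subset:
  assumes "graph_on n G" "N \<in> closed_nbhs G"
  shows "N \<subseteq> {1..n}"
proof -
  interpret pair_graph G
    using assms(1) by (simp add: graph_on_def)
  show ?thesis
    using assms arc_snd_in_verts by (fastforce simp: graph_on_def closed_nbhs_def closed_nbh_def)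
qed

lemma finite_closed_nbhs: "graph_on n G \<Longrightarrow> finite (closed_nbhs G)"
  by (simp add: graph_on_def closed_nbhs_def)

lemma card_closed_nbhs: "graph_on n G \<Longrightarrow> card (closed_nbhs G) \<le> n"
  using card_image_le[of "{1..n}" "closed_nbh G"] by (simp add: graph_on_def closed_nbhs_def)

text \<open>Some closed neighbourhood \<open>N\<close> misses \<open>U\<close>. Adding any
  \<open>j\<close> outside \<open>U\<close> makes the set meet \<open>N\<close>, which can only
  happen at \<open>j\<close>; so \<open>N\<close> contains the whole complement.\<close>

lemma compl_of_maximal_nondominating:
  assumes G: "graph_on n G" and U: "U \<subseteq> {1..n}" "\<not> dominating_set G U"
    and max: "\<And>j. j \<in> {1..n} - U \<Longrightarrow> dominating_set G (insert j U)"
  shows "{1..n} - U \<in> closed_nbhs G"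
proof -
  have "pverts G = {1..n}"
    using G by (simp add: graph_on_def)
  then obtain N where N: "N \<in> closed_nbhs G" "N \<inter> U = {}"
    using U by (auto simp: dominating_set_iff)
  have "{1..n} - U \<subseteq> N"
    using max N unfolding dominating_set_iff by blast
  then have "N = {1..n} - U"
    using N closed_nbhs_subset[OF G N(1)] by blast
  then show ?thesis
    using N by simp
qed

section \<open>The invariant of the learner and the count of queries\<close>

fun clauses :: "state \<Rightarrow> nat set list" where
  "clauses (Hypothesis Ks) = Ks"
| "clauses (Extending Ks U i) = Ks"

text \<open>Queries already asked in the current round: at \<open>Extending Ks U i\<close> these are
  one equivalence query and \<open>i - 1\<close> membership queries.\<close>

fun position :: "state \<Rightarrow> nat" where
  "position (Hypothesis Ks) = 0"
| "position (Extending Ks U i) = i"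

fun extension_inv :: "nat \<Rightarrow> vgraph \<Rightarrow> state \<Rightarrow> bool" where
  "extension_inv n G (Hypothesis Ks) \<longleftrightarrow> True"
| "extension_inv n G (Extending Ks U i) \<longleftrightarrow>
     U \<subseteq> {1..n} \<and> \<not> dominating_set G U \<and> (\<forall>K\<in>set Ks. K \<inter> U \<noteq> {}) \<and> i \<in> {1..n} \<and>
     (\<forall>j\<in>{1..<i} - U. dominating_set G (insert j U))"

definition learner_inv :: "nat \<Rightarrow> vgraph \<Rightarrow> nat \<Rightarrow> state \<Rightarrow> bool" where
  "learner_inv n G m s \<longleftrightarrow>
     distinct (clauses s) \<and> set (clauses s) \<subseteq> closed_nbhs G \<and>
     m = length (clauses s) * (n + 1) + position s \<and> extension_inv n G s"

lemma accepts_cnf: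
  assumes "graph_on n G" "set Ks \<subseteq> closed_nbhs G"
  shows "accepts (compile (cnf n Ks) 0) U \<longleftrightarrow> (\<forall>K\<in>set Ks. K \<inter> U \<noteq> {})"
  using assms closed_nbhs_subset[OF assms(1)]
  unfolding accepts_compile holds_cnf by blast

lemma learner_inv_next_state:
  assumes G: "graph_on n G" and inv: "learner_inv n G m s"
    and a: "correct_answer dominating_set G (query_of n s) a" "a \<noteq> Finished"
  shows "learner_inv n G (Suc m) (next_state n s a)"
proof (cases s)
  case (Hypothesis Ks)
  have V: "pverts G = {1..n}"
    using G by (simp add: graph_on_def)
  have Ks: "set Ks \<subseteq> closed_nbhs G"
    using inv Hypothesis by (simp add: learner_inv_def)
  note acc = accepts_cnf[OF G Ks]
  show ?thesis
  proof (cases a)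
    case (NegativeCounterexample U)
    then have U: "U \<subseteq> {1..n}" "\<not> dominating_set G U" "\<forall>K\<in>set Ks. K \<inter> U \<noteq> {}"
      using a Hypothesis V by (auto simp: acc solutions_def)
    \<comment> \<open>For \<open>n = 0\<close> the empty set dominates, so no counterexample exists.
      This puts the start vertex 1 in range.\<close>
    then have "n \<ge> 1"
      using V by (cases n) (auto simp: dominating_set_def)
    then show ?thesis
      using U inv Hypothesis NegativeCounterexample by (simp add: learner_inv_def)
  next
    case (PositiveCounterexample U)
    \<comment> \<open>A solution meets every closed neighbourhood, hence all of \<open>Ks\<close>,
      and is accepted.\<close>
    then have False
      using a Hypothesis Ks by (auto simp: acc solutions_def dominating_set_iff)
    then show ?thesis ..
  qed (use a Hypothesis in auto)
next
  case (Extending Ks U i)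
  have V: "pverts G = {1..n}"
    using G by (simp add: graph_on_def)
  have inv': "distinct Ks" "set Ks \<subseteq> closed_nbhs G" "m = length Ks * (n + 1) + i"
      "U \<subseteq> {1..n}" "\<not> dominating_set G U" "\<forall>K\<in>set Ks. K \<inter> U \<noteq> {}" "i \<in> {1..n}"
      "\<forall>j\<in>{1..<i} - U. dominating_set G (insert j U)"
    using inv Extending by (simp_all add: learner_inv_def)
  have "insert i U \<inter> {1..n} = insert i U"
    using inv' by auto
  then have a': "a = MembershipAnswer (dominating_set G (insert i U))"
    using a Extending by (cases a) auto
  define U' where "U' = (if dominating_set G (insert i U) then U else insert i U)"
  have U': "U' \<subseteq> {1..n}" "\<not> dominating_set G U'" "\<forall>K\<in>set Ks. K \<inter> U' \<noteq> {}"
    using inv' by (auto simp: U'_def)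
  \<comment> \<open>A vertex rejected earlier stays rejected as the set grows, because domination is
    upward closed inside \<open>{1..n}\<close>. The vertex \<open>i\<close> is left out only after a
    positive answer.\<close>
  have max: "dominating_set G (insert j U')" if "j \<in> {1..<Suc i} - U'" for j
  proof (cases "j = i")
    case True
    then show ?thesis
      using that by (auto simp: U'_def split: if_splits)
  next
    case False
    then have "dominating_set G (insert j U)"
      using that inv' by (auto simp: U'_def split: if_splits)
    moreover have "insert j U' \<subseteq> {1..n}" "insert j U \<subseteq> insert j U'"
      using that inv' by (auto simp: U'_def)
    ultimately show ?thesis
      unfolding dominating_set_iff V by blast
  qed
  show ?thesis
  proof (cases "i = n")
    case True
    have "{1..n} - U' \<in> closed_nbhs G"
      using max True by (intro compl_of_maximal_nondominating[OF G U'(1,2)]) auto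
    \<comment> \<open>Every old clause meets \<open>U'\<close>, while the new one is disjoint from
      it.\<close>
    moreover have "{1..n} - U' \<notin> set Ks"
      using U'(3) by blast
    moreover have "next_state n s a = Hypothesis (({1..n} - U') # Ks)"
      using True Extending by (simp add: a' U'_def)
    ultimately show ?thesis
      using inv' True by (simp add: learner_inv_def)
  next
    case False
    moreover have "next_state n s a = Extending Ks U' (Suc i)"
      using False Extending by (simp add: a' U'_def)
    ultimately show ?thesis
      using inv' U' max by (simp add: learner_inv_def)
  qed
qed

text \<open>The distinct clauses are among at most \<open>n\<close> closed neighbourhoods. During an
  extension, \<open>U\<close> misses one that is not yet listed, so fewer than \<open>n\<close> are
  known and the budget still covers the whole current round.\<close>

lemma learner_inv_bound:
  assumes G: "graph_on n G" and inv: "learner_inv n G m s"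
  shows "m \<le> n * (n + 1)"
proof -
  have fin: "finite (closed_nbhs G)" and card: "card (closed_nbhs G) \<le> n"
    using G by (auto intro: finite_closed_nbhs card_closed_nbhs)
  have len: "length (clauses s) = card (set (clauses s))"
    and sub: "set (clauses s) \<subseteq> closed_nbhs G"
    and m: "m = length (clauses s) * (n + 1) + position s"
    using inv by (simp_all add: learner_inv_def distinct_card)
  show ?thesis
  proof (cases s)
    case (Hypothesis Ks)
    have "length (clauses s) \<le> n"
      using len card card_mono[OF fin sub] by simp
    then have "length (clauses s) * (n + 1) \<le> n * (n + 1)"
      by (rule mult_le_mono1)
    then show ?thesis
      using m Hypothesis by simp
  next
    case (Extending Ks U i)
    then have "U \<subseteq> pverts G" "\<not> dominating_set G U" "\<forall>K\<in>set Ks. K \<inter> U \<noteq> {}" "i \<le> n"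
      using inv G by (auto simp: learner_inv_def graph_on_def)
    then have "set (clauses s) \<subset> closed_nbhs G"
      using sub Extending by (auto simp: dominating_set_iff)
    then have "Suc (length (clauses s)) \<le> n"
      using psubset_card_mono[OF fin] len card by (metis Suc_leI less_le_trans)
    then have "Suc (length (clauses s)) * (n + 1) \<le> n * (n + 1)"
      by (rule mult_le_mono1)
    then show ?thesis
      using m Extending \<open>i \<le> n\<close> by simp
  qed
qed

text \<open>Once finished, the play freezes and \<open>m\<close> no longer counts queries, hence the
  disjunction.\<close>

lemma finished_or_learner_inv:
  assumes "graph_on n G" "competent dominating_set n G T"
  shows "finished (play cnf_learner T n m) \<or>
    learner_inv n G m (state_of n (play cnf_learner T n m))"
proof (induction m)
  case 0
  show ?case
    by (simp add: learner_inv_def state_of_def)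
next
  case (Suc m)
  define h where "h = play cnf_learner T n m"
  define q where "q = query_of n (state_of n h)"
  have play: "play cnf_learner T n (Suc m) = (if finished h then h else h @ [(q, T h q)])"
    by (simp add: Let_def h_def q_def cnf_learner_def)
  show ?case
  proof (cases "finished h \<or> T h q = Finished")
    case True
    then show ?thesis
      unfolding play by (auto simp: finished_def)
  next
    case False
    have "correct_answer dominating_set G q (T h q)"
      using assms(2) by (simp add: competent_def q_def legal_query_of)
    then have "learner_inv n G (Suc m) (next_state n (state_of n h) (T h q))"
      using learner_inv_next_state[OF assms(1)] False Suc.IH unfolding q_def h_def by blast
    then show ?thesis
      unfolding play using False by (simp add: state_of_snoc)
  qed
qed

theorem theorem2p3:
  "\<exists>(L :: learner) (f :: nat \<Rightarrow> nat).
     learning_algorithm dominating_set L \<and>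
     runs_in_rounds dominating_set L f \<and>
     (\<lambda>n. real (f n)) \<in> O(\<lambda>n. real n ^ 2)"
proof (intro exI conjI)
  \<comment> \<open>One more than the bound on unfinished plays: at this length the invariant is
    impossible, so the play has finished.\<close>
  let ?f = "\<lambda>n. n * (n + 1) + 1 :: nat"
  show runs: "runs_in_rounds dominating_set cnf_learner ?f"
    unfolding runs_in_rounds_def
    using finished_or_learner_inv learner_inv_bound by fastforce
  then show "learning_algorithm dominating_set cnf_learner"
    using learner_strategy_cnf_learner unfolding learning_algorithm_def runs_in_rounds_def by blast
  show "(\<lambda>n. real (?f n)) \<in> O(\<lambda>n. real n ^ 2)"
  \<comment> \<open>For \<open>n\<close> at least 1, each of the three summands of
    \<open>n * n + n + 1\<close> is at most \<open>n * n\<close>.\<close>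
  proof (rule bigoI[where c = 3])
    have "real (?f n) \<le> 3 * real n ^ 2" if "n \<ge> 1" for n
    proof -
      have "1 \<le> n * n" "n \<le> n * n"
        using that by simp_all
      then have "?f n \<le> 3 * n ^ 2"
        unfolding power2_eq_square distrib_left by linarith
      then show ?thesis
        by (metis of_nat_le_iff of_nat_mult of_nat_numeral of_nat_power)
    qed
    then show "\<forall>\<^sub>F n in at_top. norm (real (?f n)) \<le> 3 * norm (real n ^ 2)"
      by (intro eventually_at_top_linorderI[of 1]) simp
  qed
qed

end
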